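(* For every integer $n\ge1$, $$r_n=\sum_{\pi\in\mathrm{NC}(n+1)}\ \prod_{S\in\pi}c_{|S|-1},$$ where $r_n$ is the large Schr\"oder number, $\mathrm{NC}(n+1)$ is the set of noncrossing partitions of $\{1,\ldots,n+1\}$, and $c_k=\frac1k\binom{2k}{k-1}$ is the Catalan number if $k\ge1$, and $c_0=1$.
   Context: A noncrossing partition of $\{1,\ldots,m\}$ is a partition of $\{1,\ldots,m\}$ into nonempty disjoint blocks such that there are no distinct blocks $S,S'$ with $i_1,i_2\in S$, $j_1,j_2\in S'$ and $i_1<j_1<i_2<j_2$; the set of these is $\mathrm{NC}(m)$. The large Schr\"oder numbers $(r_n)_{n\ge0}=(1,2,6,22,90,394,\ldots)$ have generating function $\sum_{n\ge0}r_nw^n=\dfrac{1-w-\sqrt{1-6w+w^2}}{2w}$; equivalently $r_n$ is the number of lattice paths from $(0,0)$ to $(n,n)$ with steps $(1,0),(0,1),(1,1)$ that never rise above the diagonal. *)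

theory Defs
  imports
    Complex_Main
    "HOL-Library.Disjoint_Sets"
    "HOL-Computational_Algebra.Formal_Power_Series"
begin

definition noncrossing :: "nat set set \<Rightarrow> bool" where
  "noncrossing P \<longleftrightarrow>
     \<not> (\<exists>S\<in>P. \<exists>S'\<in>P. S \<noteq> S' \<and>
          (\<exists>i1\<in>S. \<exists>i2\<in>S. \<exists>j1\<in>S'. \<exists>j2\<in>S'. i1 < j1 \<and> j1 < i2 \<and> i2 < j2))"

definition NC :: "nat \<Rightarrow> nat set set set" where
  "NC m = {P. partition_on {1..m} P \<and> noncrossing P}"

lemma finite_NC: "finite (NC m)"
proof (rule finite_subset)
  show "NC m \<subseteq> Pow (Pow {1..m})"
    by (auto simp: NC_def partition_on_def)
qed simp

definition catalan :: "nat \<Rightarrow> real" where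
  "catalan k = (if k = 0 then 1 else 1 / real k * real ((2 * k) choose (k - 1)))"

text \<open>
  The radical is the power series square root of \<open>1 - 6 w + w\<^sup>2\<close> with constant coefficient
  \<open>root 2 1 = 1\<close>. The numerator below has constant coefficient 0, so the division by \<open>2 w\<close>
  is exact, see \<open>schroeder_fps_exact\<close>.
\<close>

definition schroeder_fps :: "real fps" where
  "schroeder_fps = (1 - fps_X - fps_radical root 2 (1 - 6 * fps_X + fps_X ^ 2)) / (2 * fps_X)"

definition schroeder :: "nat \<Rightarrow> real" where
  "schroeder n = fps_nth schroeder_fps n"

lemma schroeder_sqrt_power2:
  "fps_radical root 2 (1 - 6 * fps_X + fps_X ^ 2 :: real fps) ^ 2 = 1 - 6 * fps_X + fps_X ^ 2"
proof -
  have "fps_nth (1 - 6 * fps_X + fps_X ^ 2 :: real fps) 0 = 1"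
    by simp
  then show ?thesis
    using power_radical[of "1 - 6 * fps_X + fps_X ^ 2 :: real fps" root 1]
    by (simp add: numeral_2_eq_2)
qed

lemma schroeder_fps_exact:
  "2 * fps_X * schroeder_fps = 1 - fps_X - fps_radical root 2 (1 - 6 * fps_X + fps_X ^ 2)"
    (is "_ = ?N")
proof -
  have "fps_nth ?N 0 = 0"
    by simp
  then have "?N = fps_X * fps_shift 1 ?N"
    by (intro fps_ext) (simp only: fps_X_mult_nth fps_shift_nth, simp)
  then have "fps_X dvd ?N"
    by (rule dvdI)
  moreover have "(2 :: real fps) dvd 1"
    by (simp add: fps_is_unit_iff)
  ultimately have "2 * fps_X dvd ?N"
    by (metis mult_dvd_mono dvd_trans mult_1_left dvd_refl)
  then show ?thesis
    by (simp add: schroeder_fps_def)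
qed

lemma schroeder_fps_equation:
  "schroeder_fps = 1 + fps_X * schroeder_fps + fps_X * schroeder_fps ^ 2"
proof -
  let ?R = schroeder_fps
  have "(1 - fps_X - 2 * fps_X * ?R) ^ 2 = 1 - 6 * fps_X + fps_X ^ 2"
    using schroeder_sqrt_power2 by (simp add: schroeder_fps_exact)
  then have "(4 * fps_X) * ?R = (4 * fps_X) * (1 + fps_X * ?R + fps_X * ?R ^ 2)"
    by (simp add: power2_eq_square algebra_simps)
  then show ?thesis
    by (subst (asm) mult_cancel_left) auto
qed

lemma schroeder_0: "schroeder 0 = 1"
  using arg_cong[OF schroeder_fps_equation, of "\<lambda>f. fps_nth f 0"]
  by (simp add: schroeder_def)

lemma schroeder_Suc:
  "schroeder (Suc n) = schroeder n + (\<Sum>i\<le>n. schroeder i * schroeder (n - i))"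
  using arg_cong[OF schroeder_fps_equation, of "\<lambda>f. fps_nth f (Suc n)"]
  by (simp only: fps_add_nth fps_X_mult_nth)
    (simp add: schroeder_def power2_eq_square fps_mult_nth atLeast0AtMost)

lemma schroeder_initial_values:
  "map schroeder [0, 1, 2, 3, 4, 5] = [1, 2, 6, 22, 90, 394]"
  by (simp add: eval_nat_numeral schroeder_0 schroeder_Suc)

end

theory Submission
  imports Defs
begin

unbundle fps_syntax

text \<open>
  Give a block of size \<open>k\<close> an arbitrary weight \<open>w k\<close>, and let \<open>M\<close> be the generating function, by the
  size of the ground set, of the weighted sum over all noncrossing partitions. Fix the block of the
  least point. Its \<open>k\<close> points cut the remaining points into \<open>k\<close> gaps, and each gap carries an
  arbitrary noncrossing partition, so \<open>M = 1 + (\<Sum>k\<ge>1. w k * (X * M) ^ k) = 1 + W(X * M)\<close>, where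
  \<open>W = (\<Sum>k\<ge>1. w k * X ^ k)\<close>. This is \<open>nc_fps_compose\<close>.

  For \<open>w k = c\<^bsub>k - 1\<^esub>\<close> the series \<open>W\<close> is \<open>X\<close> times the Catalan series, hence \<open>W = X + W\<^sup>2\<close>
  (\<open>catalan_fps_equation\<close>). Composing with \<open>X * M\<close>, the series \<open>D = M - 1\<close> satisfies
  \<open>D = X * M + D\<^sup>2 = X + X * D + D\<^sup>2\<close>. If \<open>R\<close> is the Schroeder series, then \<open>X * R\<close> satisfies the
  same equation, because \<open>R = 1 + X * R + X * R\<^sup>2\<close>. The equation has only one solution without
  constant term (\<open>quadratic_fps_unique\<close>), so \<open>D = X * R\<close>; compare the coefficients of \<open>X ^ (n + 1)\<close>.

  The gaps are split off one at a time, so that every step is a bijection with pairs rather than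
  with tuples of varying length. When the first gap, between the least point \<open>a\<close> and the next point
  \<open>s\<close> of its block, is split off, \<open>a\<close> is deleted and \<open>s\<close> becomes the least point of what is left.
  To keep the weight of the truncated block, its size is counted with an offset \<open>j\<close>, the number
  of points deleted so far. The resulting recurrence is \<open>rooted_sum_rec\<close>.
\<close>

section \<open>Cutting and gluing noncrossing partitions\<close>

definition nc_partitions :: "nat set \<Rightarrow> nat set set set" where
  "nc_partitions A = {P. partition_on A P \<and> noncrossing P}"

lemma finite_nc_partitions:
  assumes "finite A"
  shows "finite (nc_partitions A)"
  using finitely_many_partition_on[OF assms]
  by (rule rev_finite_subset) (auto simp: nc_partitions_def)

lemma noncrossing_eqI:
  assumes "noncrossing P" "S \<in> P" "S' \<in> P" "i1 \<in> S" "i2 \<in> S" "j1 \<in> S'" "j2 \<in> S'"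
    and "i1 < j1" "j1 < i2" "i2 < j2"
  shows "S = S'"
  using assms(1)[unfolded noncrossing_def] assms(2-) by metis

lemma noncrossing_insert_singleton: "noncrossing (insert {a} P) \<longleftrightarrow> noncrossing P"
proof
  show "noncrossing P" if "noncrossing (insert {a} P)"
    using noncrossing_eqI[OF that] unfolding noncrossing_def by (metis insertI2)
  show "noncrossing (insert {a} P)" if "noncrossing P"
    unfolding noncrossing_def
  proof (intro notI, elim bexE conjE)
    fix S S' i1 i2 j1 j2
    assume *: "S \<in> insert {a} P" "S' \<in> insert {a} P" "S \<noteq> S'"
      "i1 \<in> S" "i2 \<in> S" "j1 \<in> S'" "j2 \<in> S'" "i1 < j1" "j1 < i2" "i2 < j2"
    have "S \<noteq> {a}" "S' \<noteq> {a}"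
      using *(4-) by auto
    then show False
      using noncrossing_eqI[OF that, of S S' i1 i2 j1 j2] * by simp
  qed
qed

lemma nc_partitions_block_eqI:
  assumes "P \<in> nc_partitions A" "S \<in> P" "S' \<in> P" "x \<in> S" "x \<in> S'"
  shows "S = S'"
  using assms disjointD[of P S S'] by (auto simp: nc_partitions_def partition_on_def)

lemma nc_partitions_blockD:
  assumes "P \<in> nc_partitions A" "S \<in> P"
  shows "S \<subseteq> A" "S \<noteq> {}"
  using assms unfolding nc_partitions_def partition_on_def by blast+

definition restrict_blocks :: "'a set \<Rightarrow> 'a set set \<Rightarrow> 'a set set" where
  "restrict_blocks B P = (\<inter>) B ` P - {{}}"

lemma restrict_blocks_nc_partitions:
  assumes "P \<in> nc_partitions A" "B \<subseteq> A"
  shows "restrict_blocks B P \<in> nc_partitions B"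
proof -
  have "partition_on (B \<inter> A) (restrict_blocks B P)"
    using assms unfolding nc_partitions_def restrict_blocks_def by (blast intro: partition_on_restrict)
  moreover have "B \<inter> A = B"
    using assms by blast
  moreover have "noncrossing (restrict_blocks B P)"
    unfolding noncrossing_def
  proof (intro notI, elim bexE conjE)
    fix S S' i1 i2 j1 j2
    assume *: "S \<in> restrict_blocks B P" "S' \<in> restrict_blocks B P" "S \<noteq> S'"
      "i1 \<in> S" "i2 \<in> S" "j1 \<in> S'" "j2 \<in> S'" "i1 < j1" "j1 < i2" "i2 < j2"
    then obtain T T' where "T \<in> P" "S = B \<inter> T" "T' \<in> P" "S' = B \<inter> T'"
      unfolding restrict_blocks_def by blast
    then show False
      using noncrossing_eqI[of P T T' i1 i2 j1 j2] * assms(1) by (auto simp: nc_partitions_def)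
  qed
  ultimately show ?thesis
    by (simp add: nc_partitions_def)
qed

text \<open>
  Gluing makes \<open>a\<close> a member of the block of \<open>s\<close>, and leaves all other blocks alone. It inverts
  the restriction of a partition to the points strictly between \<open>a\<close> and \<open>s\<close>, and to the points
  from \<open>s\<close> on.
\<close>

definition adjoin :: "'a \<Rightarrow> 'a \<Rightarrow> 'a set \<Rightarrow> 'a set" where
  "adjoin a s S = (if s \<in> S then insert a S else S)"

definition glue :: "'a \<Rightarrow> 'a \<Rightarrow> 'a set set \<Rightarrow> 'a set set \<Rightarrow> 'a set set" where
  "glue a s P Q = P \<union> adjoin a s ` Q"

definition consecutive_in :: "nat set set \<Rightarrow> nat \<Rightarrow> nat \<Rightarrow> bool" where
  "consecutive_in P a s \<longleftrightarrow> (\<exists>S\<in>P. a \<in> S \<and> s \<in> S \<and> S \<inter> {a<..<s} = {})"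

context
  fixes a s b :: nat
  assumes s: "s \<in> {a<..<b}"
begin

text \<open>
  A crossing has to involve the new point \<open>a\<close>, as the blocks on the two sides of \<open>s\<close> are separated.
  Being least, \<open>a\<close> could only be the first of the four points; but then \<open>s\<close>, which lies in the same
  block and below the second point, could take its place, giving a crossing that existed before.
\<close>

lemma glue_in_nc_partitions:
  assumes P: "P \<in> nc_partitions {a<..<s}" and Q: "Q \<in> nc_partitions {s..<b}"
  shows "glue a s P Q \<in> nc_partitions {a..<b}"
proof -
  have UP: "\<Union>P = {a<..<s}" and dP: "disjoint P" and eP: "{} \<notin> P" and nP: "noncrossing P"
    using P by (simp_all add: nc_partitions_def partition_on_def)
  have UQ: "\<Union>Q = {s..<b}" and dQ: "disjoint Q" and eQ: "{} \<notin> Q" and nQ: "noncrossing Q"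
    using Q by (simp_all add: nc_partitions_def partition_on_def)
  have inP: "x \<in> {a<..<s}" if "S \<in> P" "x \<in> S" for S x
    using that UP by blast
  have inQ: "x \<in> {s..<b}" if "S \<in> Q" "x \<in> S" for S x
    using that UQ by blast
  have aQ: "a \<notin> S" if "S \<in> Q" for S
    using inQ[OF that, of a] s by auto
  have inA: "x = a \<and> s \<in> S \<or> x \<in> S" if "x \<in> adjoin a s S" for S x
    using that by (auto simp: adjoin_def split: if_splits)
  have "partition_on {a..<b} (glue a s P Q)"
  proof (rule partition_onI)
    obtain T where T: "T \<in> Q" "s \<in> T"
      using UQ s by (metis UnionE atLeastLessThan_iff greaterThanLessThan_iff order_refl)
    then have "\<Union>(adjoin a s ` Q) = insert a (\<Union>Q)"
      by (auto simp: adjoin_def)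
    then show "\<Union>(glue a s P Q) = {a..<b}"
      using UP UQ s by (auto simp: glue_def)
    show "{} \<notin> glue a s P Q"
      using eP eQ by (auto simp: glue_def adjoin_def)
    show "disjnt p q" if "p \<in> glue a s P Q" "q \<in> glue a s P Q" "p \<noteq> q" for p q
    proof -
      have PP: "disjnt p q" if "p \<in> P" "q \<in> P" "p \<noteq> q" for p q
        using that dP by (auto simp: pairwise_def)
      have PQ: "disjnt p (adjoin a s q)" if "p \<in> P" "q \<in> Q" for p q
      proof -
        have "p \<subseteq> {a<..<s}" "adjoin a s q \<subseteq> insert a {s..<b}"
          using inP[OF that(1)] inQ[OF that(2)] by (auto simp: adjoin_def)
        moreover have "{a<..<s} \<inter> insert a {s..<b} = {}"
          by auto
        ultimately show ?thesis
          unfolding disjnt_def by blast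
      qed
      have QQ: "disjnt (adjoin a s p) (adjoin a s q)"
        if "p \<in> Q" "q \<in> Q" "adjoin a s p \<noteq> adjoin a s q" for p q
      proof -
        have "p \<noteq> q"
          using that by blast
        then have "disjnt p q"
          using that dQ by (auto simp: pairwise_def)
        then show ?thesis
          using aQ[OF that(1)] aQ[OF that(2)] by (auto simp: disjnt_iff adjoin_def)
      qed
      show ?thesis
        using that unfolding glue_def
        by (elim UnE imageE) (simp_all add: PP PQ QQ disjnt_sym[OF PQ])
    qed
  qed
  moreover have "noncrossing (glue a s P Q)"
    unfolding noncrossing_def
  proof (intro notI, elim bexE conjE)
    fix S S' i1 i2 j1 j2
    assume *: "S \<in> glue a s P Q" "S' \<in> glue a s P Q" "S \<noteq> S'"
      "i1 \<in> S" "i2 \<in> S" "j1 \<in> S'" "j2 \<in> S'" "i1 < j1" "j1 < i2" "i2 < j2"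
    consider "S \<in> P" "S' \<in> P"
      | T' where "S \<in> P" "T' \<in> Q" "S' = adjoin a s T'"
      | T where "T \<in> Q" "S = adjoin a s T" "S' \<in> P"
      | T T' where "T \<in> Q" "S = adjoin a s T" "T' \<in> Q" "S' = adjoin a s T'"
      using *(1,2) unfolding glue_def by blast
    then show False
    proof cases
      case 1
      then show ?thesis
        using noncrossing_eqI[OF nP, of S S'] * by blast
    next
      case 2
      then show ?thesis
        using inP[of S i1] inP[of S i2] inQ[of T' j1] inA[of j1 T'] * by auto
    next
      case 3
      then show ?thesis
        using inP[of S' j1] inP[of S' j2] inQ[of T i2] inA[of i2 T] * by auto
    next
      case 4
      have ge: "a \<le> x" if "x \<in> adjoin a s U" "U \<in> Q" for x U
        using inA[OF that(1)] inQ[OF that(2)] s by fastforce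
      have "a \<le> i1"
        using ge 4 * by blast
      then have T: "i2 \<in> T" "j1 \<in> T'" "j2 \<in> T'"
        using inA[of i2 T] inA[of j1 T'] inA[of j2 T'] 4 * by auto
      show ?thesis
      proof (cases "i1 = a")
        case False
        then have "i1 \<in> T"
          using inA[of i1 T] 4 * by auto
        then show ?thesis
          using noncrossing_eqI[OF nQ, of T T'] 4 * T by blast
      next
        case True
        have sT: "s \<in> T"
        proof (rule ccontr)
          assume "s \<notin> T"
          then have "a \<in> T"
            using 4 * True by (simp add: adjoin_def)
          then show False
            using inQ[of T a] 4 s by auto
        qed
        show ?thesis
        proof (cases "j1 = s")
          case True
          then have "T = T'"
            using sT T 4 nc_partitions_block_eqI[OF Q] by blast
          then show ?thesis
            using 4 * by blast
        next
          case False
          then have "s < j1"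
            using inQ[of T' j1] 4 T by auto
          then show ?thesis
            using noncrossing_eqI[OF nQ, of T T' s i2 j1 j2] 4 * T sT by blast
        qed
      qed
    qed
  qed
  ultimately show ?thesis
    by (simp add: nc_partitions_def)
qed

lemma glue_consecutive_in:
  assumes Q: "Q \<in> nc_partitions {s..<b}"
  shows "consecutive_in (glue a s P Q) a s"
proof -
  have UQ: "\<Union>Q = {s..<b}"
    using Q by (auto simp: nc_partitions_def partition_on_def)
  then obtain T where T: "T \<in> Q" "s \<in> T"
    using s by (metis UnionE atLeastLessThan_iff greaterThanLessThan_iff order_refl)
  have "T \<subseteq> {s..<b}"
    using T UQ by blast
  then have "adjoin a s T \<inter> {a<..<s} = {}" "a \<in> adjoin a s T" "s \<in> adjoin a s T"
    using T by (auto simp: adjoin_def)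
  then show ?thesis
    using T unfolding consecutive_in_def glue_def by blast
qed

lemma restrict_glue:
  assumes P: "P \<in> nc_partitions {a<..<s}" and Q: "Q \<in> nc_partitions {s..<b}"
  shows "restrict_blocks {a<..<s} (glue a s P Q) = P"
    and "restrict_blocks {s..<b} (glue a s P Q) = Q"
proof -
  have subP: "S \<subseteq> {a<..<s}" "S \<noteq> {}" if "S \<in> P" for S
    using nc_partitions_blockD[OF P that] by simp_all
  have subQ: "S \<subseteq> {s..<b}" "S \<noteq> {}" if "S \<in> Q" for S
    using nc_partitions_blockD[OF Q that] by simp_all
  have eP: "{} \<notin> P" and eQ: "{} \<notin> Q"
    using subP subQ by blast+
  have 1: "{a<..<s} \<inter> S = S" "{s..<b} \<inter> S = {}" if "S \<in> P" for S
    using subP[OF that] by auto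
  have 2: "{a<..<s} \<inter> adjoin a s S = {}" "{s..<b} \<inter> adjoin a s S = S" if "S \<in> Q" for S
    using subQ[OF that] s by (auto simp: adjoin_def split: if_splits)
  have "(\<inter>) {a<..<s} ` glue a s P Q = P \<union> (\<lambda>_. {}) ` Q"
    unfolding glue_def image_Un image_image
    by (intro arg_cong2[of _ _ _ _ "(\<union>)"] image_cong) (auto simp: 1 2)
  then show "restrict_blocks {a<..<s} (glue a s P Q) = P"
    using eP unfolding restrict_blocks_def by auto
  have "(\<inter>) {s..<b} ` glue a s P Q = (\<lambda>_. {}) ` P \<union> Q"
    unfolding glue_def image_Un image_image
    by (intro arg_cong2[of _ _ _ _ "(\<union>)"] image_cong) (auto simp: 1 2)
  then show "restrict_blocks {s..<b} (glue a s P Q) = Q"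
    using eQ unfolding restrict_blocks_def by auto
qed

text \<open>
  This is where the absence of crossings matters: a block other than that of \<open>a\<close> and \<open>s\<close> with
  points on both sides of \<open>s\<close> would cross the pair \<open>a\<close>, \<open>s\<close>. So every other block survives unchanged
  in one of the two restrictions.
\<close>

lemma glue_restrict:
  assumes P: "P \<in> nc_partitions {a..<b}" and con: "consecutive_in P a s"
  shows "glue a s (restrict_blocks {a<..<s} P) (restrict_blocks {s..<b} P) = P"
proof -
  obtain R where R: "R \<in> P" "a \<in> R" "s \<in> R" "R \<inter> {a<..<s} = {}"
    using con by (auto simp: consecutive_in_def)
  have sub: "S \<subseteq> {a..<b}" "S \<noteq> {}" if "S \<in> P" for S
    using nc_partitions_blockD[OF P that] by simp_all
  have nc: "noncrossing P"
    using P by (simp add: nc_partitions_def)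
  have R2: "adjoin a s ({s..<b} \<inter> R) = R"
    using R sub[OF R(1)] s by (force simp: adjoin_def)
  have other: "S \<subseteq> {a<..<s} \<or> S \<subseteq> {s<..<b}" if S: "S \<in> P" "S \<noteq> R" for S
  proof -
    have nx: "a \<notin> S" "s \<notin> S"
      using S R nc_partitions_block_eqI[OF P] by blast+
    have "\<not> (x \<in> S \<and> y \<in> S \<and> x < s \<and> s < y)" for x y
    proof
      assume *: "x \<in> S \<and> y \<in> S \<and> x < s \<and> s < y"
      then have "a < x"
        using sub[OF S(1)] nx by (metis atLeastLessThan_iff order_le_less subsetD)
      then show False
        using noncrossing_eqI[OF nc R(1) S(1), of a s x y] R S * by blast
    qed
    then have "(\<forall>x\<in>S. x < s) \<or> (\<forall>x\<in>S. s < x)"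
      using nx by (metis linorder_neqE_nat)
    then show ?thesis
    proof (elim disjE)
      assume "\<forall>x\<in>S. x < s"
      moreover have "x \<noteq> a" if "x \<in> S" for x
        using nx that by blast
      ultimately show ?thesis
        using sub(1)[OF S(1)] by (force simp: order_le_less)
    next
      assume "\<forall>x\<in>S. s < x"
      then show ?thesis
        using sub(1)[OF S(1)] by force
    qed
  qed
  have low: "S = {a<..<s} \<inter> S" if "S \<subseteq> {a<..<s}" for S
    using that by blast
  have high: "adjoin a s ({s..<b} \<inter> S) = S" if "S \<subseteq> {s<..<b}" for S
    using that by (force simp: adjoin_def)
  show ?thesis
  proof (intro equalityI subsetI)
    fix S assume S: "S \<in> P"
    consider "S = R" | "S \<subseteq> {a<..<s}" | "S \<subseteq> {s<..<b}"
      using other[OF S] by blast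
    then show "S \<in> glue a s (restrict_blocks {a<..<s} P) (restrict_blocks {s..<b} P)"
    proof cases
      case 1
      then have "{s..<b} \<inter> R \<in> restrict_blocks {s..<b} P"
        using R s by (auto simp: restrict_blocks_def)
      then show ?thesis
        using R2 1 unfolding glue_def by (metis UnI2 imageI)
    next
      case 2
      then have "S \<in> restrict_blocks {a<..<s} P"
        using low[OF 2] S sub[OF S] by (auto simp: restrict_blocks_def)
      then show ?thesis
        by (simp add: glue_def)
    next
      case 3
      then have "{s..<b} \<inter> S = S"
        by auto
      then have "{s..<b} \<inter> S \<noteq> {}"
        using sub(2)[OF S] by simp
      then have "{s..<b} \<inter> S \<in> restrict_blocks {s..<b} P"
        using S by (auto simp: restrict_blocks_def)
      then show ?thesis
        using high[OF 3] unfolding glue_def by (metis UnI2 imageI)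
    qed
  next
    fix S assume "S \<in> glue a s (restrict_blocks {a<..<s} P) (restrict_blocks {s..<b} P)"
    then consider T where "T \<in> P" "S = {a<..<s} \<inter> T" "S \<noteq> {}"
      | T where "T \<in> P" "S = adjoin a s ({s..<b} \<inter> T)" "{s..<b} \<inter> T \<noteq> {}"
      unfolding glue_def restrict_blocks_def by blast
    then show "S \<in> P"
    proof cases
      case 1
      then have "T \<noteq> R"
        using R by blast
      with 1 other[of T] have "T \<subseteq> {a<..<s}"
        by fastforce
      with 1 low[of T] show ?thesis
        by simp
    next
      case 2
      show ?thesis
      proof (cases "T = R")
        case True
        with 2 R R2 show ?thesis by simp
      next
        case False
        with 2 other[of T] have "T \<subseteq> {s<..<b}"
          by fastforce
        with 2 high[of T] show ?thesis
          by simp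
      qed
    qed
  qed
qed

end

section \<open>The recurrence for weighted sums\<close>

text \<open>
  The root is the block of \<open>a\<close>; it is weighted as if it had \<open>j\<close> more points. For \<open>j = 0\<close> this is the
  plain product of block weights, whatever \<open>a\<close> is.
\<close>

definition rooted_weight :: "(nat \<Rightarrow> 'a::comm_semiring_1) \<Rightarrow> nat \<Rightarrow> nat \<Rightarrow> nat set set \<Rightarrow> 'a" where
  "rooted_weight w j a P = (\<Prod>S\<in>P. w (card S + (if a \<in> S then j else 0)))"

definition rooted_sum :: "(nat \<Rightarrow> 'a::comm_semiring_1) \<Rightarrow> nat \<Rightarrow> nat \<Rightarrow> nat \<Rightarrow> 'a" where
  "rooted_sum w j a b = (\<Sum>P\<in>nc_partitions {a..<b}. rooted_weight w j a P)"

text \<open>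
  The glued root has one point more than the root at \<open>s\<close>, which is why the offset grows by one. In
  the gap all blocks are ordinary, whence the offset 0 there.
\<close>

lemma rooted_weight_glue:
  assumes s: "s \<in> {a<..<b}"
    and P: "P \<in> nc_partitions {a<..<s}" and Q: "Q \<in> nc_partitions {s..<b}"
  shows "rooted_weight w j a (glue a s P Q) = rooted_weight w 0 (Suc a) P * rooted_weight w (Suc j) s Q"
proof -
  have fin: "finite P" "finite Q"
    using P Q finite_elements by (force simp: nc_partitions_def)+
  have subP: "S \<subseteq> {a<..<s}" "S \<noteq> {}" if "S \<in> P" for S
    using nc_partitions_blockD[OF P that] by simp_all
  have subQ: "S \<subseteq> {s..<b}" "S \<noteq> {}" if "S \<in> Q" for S
    using nc_partitions_blockD[OF Q that] by simp_all
  have aQ: "a \<notin> S" if "S \<in> Q" for S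
    using subQ[OF that] s by auto
  have aP: "a \<notin> S" if "S \<in> P" for S
    using subP[OF that] by auto
  have inj: "inj_on (adjoin a s) Q"
  proof (rule inj_onI)
    fix S T assume "S \<in> Q" "T \<in> Q" and eq: "adjoin a s S = adjoin a s T"
    have "adjoin a s U - {a} = U" if "U \<in> Q" for U
      using aQ[OF that] by (auto simp: adjoin_def)
    then show "S = T"
      using eq \<open>S \<in> Q\<close> \<open>T \<in> Q\<close> by metis
  qed
  have disj: "P \<inter> adjoin a s ` Q = {}"
  proof -
    have "adjoin a s S \<notin> P" if "S \<in> Q" for S
      using subP[of "adjoin a s S"] subQ[OF that] by (auto simp: adjoin_def split: if_splits) force
    then show ?thesis by blast
  qed
  have "rooted_weight w j a (glue a s P Q) =
      (\<Prod>S\<in>P. w (card S + (if a \<in> S then j else 0))) *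
      (\<Prod>S\<in>Q. w (card (adjoin a s S) + (if a \<in> adjoin a s S then j else 0)))"
    unfolding rooted_weight_def glue_def
    using fin disj inj by (simp add: prod.union_disjoint prod.reindex)
  also have "(\<Prod>S\<in>P. w (card S + (if a \<in> S then j else 0))) = rooted_weight w 0 (Suc a) P"
    unfolding rooted_weight_def using aP by (intro prod.cong) auto
  also have "(\<Prod>S\<in>Q. w (card (adjoin a s S) + (if a \<in> adjoin a s S then j else 0))) =
      rooted_weight w (Suc j) s Q"
    unfolding rooted_weight_def
  proof (intro prod.cong refl)
    fix S assume S: "S \<in> Q"
    have "finite S"
      using subQ[OF S] finite_subset by blast
    then show "w (card (adjoin a s S) + (if a \<in> adjoin a s S then j else 0)) =
        w (card S + (if s \<in> S then Suc j else 0))"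
      using aQ[OF S] by (simp add: adjoin_def)
  qed
  finally show ?thesis .
qed

lemma sum_consecutive:
  assumes s: "s \<in> {a<..<b}"
  shows "(\<Sum>P | P \<in> nc_partitions {a..<b} \<and> consecutive_in P a s. rooted_weight w j a P) =
    rooted_sum w 0 (Suc a) s * rooted_sum w (Suc j) s b"
proof -
  have "(\<Sum>(P, Q)\<in>nc_partitions {a<..<s} \<times> nc_partitions {s..<b}.
      rooted_weight w 0 (Suc a) P * rooted_weight w (Suc j) s Q) =
    (\<Sum>P | P \<in> nc_partitions {a..<b} \<and> consecutive_in P a s. rooted_weight w j a P)"
  proof (rule sum.reindex_bij_witness[where j = "\<lambda>(P, Q). glue a s P Q" and
        i = "\<lambda>P. (restrict_blocks {a<..<s} P, restrict_blocks {s..<b} P)"]; clarsimp)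
    have "{a<..<s} \<subseteq> {a..<b}" "{s..<b} \<subseteq> {a..<b}"
      using s by auto
    then show "restrict_blocks {a<..<s} P \<in> nc_partitions {a<..<s} \<and>
        restrict_blocks {s..<b} P \<in> nc_partitions {s..<b}"
      if "P \<in> nc_partitions {a..<b}" for P
      using restrict_blocks_nc_partitions[OF that] by blast
  qed (simp_all add: restrict_glue[OF s] glue_restrict[OF s] glue_in_nc_partitions[OF s]
        glue_consecutive_in[OF s] rooted_weight_glue[OF s])
  moreover have "{a<..<s} = {Suc a..<s}"
    by auto
  ultimately show ?thesis
    by (simp add: rooted_sum_def sum_product sum.cartesian_product)
qed

lemma sum_singleton_root:
  assumes "a < b"
  shows "(\<Sum>P | P \<in> nc_partitions {a..<b} \<and> {a} \<in> P. rooted_weight w j a P) =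
    w (Suc j) * rooted_sum w 0 (Suc a) b"
proof -
  have sub: "a \<notin> S" if "P \<in> nc_partitions {Suc a..<b}" "S \<in> P" for P S
    using nc_partitions_blockD(1)[OF that] by auto
  have na: "{a} \<notin> P" if "P \<in> nc_partitions {Suc a..<b}" for P
    using sub[OF that] by blast
  have fin: "finite P" if "P \<in> nc_partitions {Suc a..<b}" for P
    using that finite_elements[of "{Suc a..<b}" P] by (simp add: nc_partitions_def)
  have part: "partition_on {a..<b} (insert {a} P) \<longleftrightarrow> partition_on {Suc a..<b} P"
    if "disjnt {a} (\<Union>P)" for P
  proof -
    have "{a..<b} - {a} = {Suc a..<b}"
      using assms by auto
    then show ?thesis
      using that assms by (simp add: partition_on_insert)
  qed
  have "(\<Sum>P\<in>nc_partitions {Suc a..<b}. w (Suc j) * rooted_weight w 0 (Suc a) P) =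
    (\<Sum>P | P \<in> nc_partitions {a..<b} \<and> {a} \<in> P. rooted_weight w j a P)"
  proof (rule sum.reindex_bij_witness[where j = "insert {a}" and i = "\<lambda>P. P - {{a}}"])
    fix P assume P: "P \<in> nc_partitions {Suc a..<b}"
    show "insert {a} P - {{a}} = P"
      using na[OF P] by blast
    show "insert {a} P \<in> {P \<in> nc_partitions {a..<b}. {a} \<in> P}"
      using P part[of P] sub[OF P]
      by (auto simp: nc_partitions_def noncrossing_insert_singleton)
    show "rooted_weight w j a (insert {a} P) = w (Suc j) * rooted_weight w 0 (Suc a) P"
      using na[OF P] fin[OF P] sub[OF P] by (simp add: rooted_weight_def)
  next
    fix P assume P: "P \<in> {P \<in> nc_partitions {a..<b}. {a} \<in> P}"
    then show "insert {a} (P - {{a}}) = P"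
      by blast
    moreover have "disjnt {a} (\<Union>(P - {{a}}))"
      using P nc_partitions_block_eqI[of P _ "{a}"] by auto
    ultimately show "P - {{a}} \<in> nc_partitions {Suc a..<b}"
      using P part[of "P - {{a}}"] noncrossing_insert_singleton[of a "P - {{a}}"]
      by (simp add: nc_partitions_def)
  qed
  then show ?thesis
    by (simp add: rooted_sum_def sum_distrib_left)
qed

text \<open>
  Either the root is the singleton \<open>{a}\<close>, or it has a well-defined second smallest point \<open>s\<close>.
\<close>

lemma rooted_sum_rec:
  assumes "a < b"
  shows "rooted_sum w j a b = w (Suc j) * rooted_sum w 0 (Suc a) b +
    (\<Sum>s\<in>{a<..<b}. rooted_sum w 0 (Suc a) s * rooted_sum w (Suc j) s b)"
proof -
  let ?N = "nc_partitions {a..<b}"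
  let ?C = "\<lambda>s. {P \<in> ?N. consecutive_in P a s}"
  have fin: "finite ?N"
    by (simp add: finite_nc_partitions)
  have "\<exists>s\<in>{a<..<b}. consecutive_in P a s" if P: "P \<in> ?N" and "{a} \<notin> P" for P
  proof -
    have "\<Union>P = {a..<b}"
      using P by (simp add: nc_partitions_def partition_on_def)
    then obtain S where S: "S \<in> P" "a \<in> S" "S \<subseteq> {a..<b}"
      using assms by (metis UnionE Union_upper atLeastLessThan_iff order_refl)
    define s where "s = Min (S - {a})"
    have "S \<noteq> {a}"
      using S that by blast
    then have ne: "S - {a} \<noteq> {}"
      using S by blast
    moreover have fin: "finite (S - {a})"
      using S finite_subset by blast
    ultimately have "s \<in> S - {a}"
      unfolding s_def by (intro Min_in)
    moreover have min: "\<forall>x\<in>S - {a}. s \<le> x"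
      unfolding s_def using fin by simp
    moreover have "S \<inter> {a<..<s} = {}"
    proof -
      have "x \<notin> {a<..<s}" if "x \<in> S" for x
        using bspec[OF min, of x] that by (cases "x = a") auto
      then show ?thesis by blast
    qed
    ultimately show ?thesis
      using S unfolding consecutive_in_def by (intro bexI[of _ s] bexI[of _ S]) auto
  qed
  then have N: "?N = {P \<in> ?N. {a} \<in> P} \<union> (\<Union>s\<in>{a<..<b}. ?C s)"
    by blast
  have uniq: "s = t"
    if P: "P \<in> ?N" and con: "consecutive_in P a s" "consecutive_in P a t" and less: "a < s" "a < t"
    for P s t
  proof -
    obtain S where S: "S \<in> P" "a \<in> S" "s \<in> S" "S \<inter> {a<..<s} = {}"
      using con(1) unfolding consecutive_in_def by blast
    obtain T where T: "T \<in> P" "a \<in> T" "t \<in> T" "T \<inter> {a<..<t} = {}"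
      using con(2) unfolding consecutive_in_def by blast
    have "S = T"
      using nc_partitions_block_eqI[OF P S(1) T(1) S(2) T(2)] .
    then show ?thesis
      using S T less by (metis disjoint_iff greaterThanLessThan_iff linorder_neqE_nat)
  qed
  have single: "\<not> consecutive_in P a s" if "P \<in> ?N" "{a} \<in> P" "a < s" for P s
    using that nc_partitions_block_eqI[OF that(1)] unfolding consecutive_in_def by blast
  have "rooted_sum w j a b = (\<Sum>P | P \<in> ?N \<and> {a} \<in> P. rooted_weight w j a P) +
      (\<Sum>P\<in>(\<Union>s\<in>{a<..<b}. ?C s). rooted_weight w j a P)"
    unfolding rooted_sum_def by (subst N, rule sum.union_disjoint) (use fin single in auto)
  also have "(\<Sum>P\<in>(\<Union>s\<in>{a<..<b}. ?C s). rooted_weight w j a P) =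
      (\<Sum>s\<in>{a<..<b}. \<Sum>P\<in>?C s. rooted_weight w j a P)"
    by (rule sum.UNION_disjoint) (use fin uniq in auto)
  finally show ?thesis
    using assms by (simp add: sum_consecutive sum_singleton_root)
qed

lemma rooted_sum_empty: "rooted_sum w j a a = 1"
proof -
  have "nc_partitions {} = {{}}"
    by (auto simp: nc_partitions_def partition_on_empty noncrossing_def)
  then show ?thesis
    by (simp add: rooted_sum_def rooted_weight_def)
qed

lemma rooted_sum_Suc:
  "rooted_sum w j a (a + Suc n) = w (Suc j) * rooted_sum w 0 (Suc a) (Suc a + n) +
    (\<Sum>i<n. rooted_sum w 0 (Suc a) (Suc a + i) * rooted_sum w (Suc j) (Suc a + i) (Suc a + i + (n - i)))"
proof -
  have "(\<Sum>s\<in>{a<..<a + Suc n}. rooted_sum w 0 (Suc a) s * rooted_sum w (Suc j) s (a + Suc n)) =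
    (\<Sum>i<n. rooted_sum w 0 (Suc a) (Suc a + i) * rooted_sum w (Suc j) (Suc a + i) (Suc a + i + (n - i)))"
    by (rule sum.reindex_bij_witness[where j = "\<lambda>s. s - Suc a" and i = "\<lambda>i. Suc a + i"])
      (auto simp: add.commute)
  then show ?thesis
    by (simp add: rooted_sum_rec)
qed

text \<open>
  The recurrence mentions positions only through the lengths of intervals, and therefore so does its
  solution.
\<close>

lemma rooted_sum_shift: "rooted_sum w j a (a + n) = rooted_sum w j 0 n"
proof (induction n arbitrary: j a rule: less_induct)
  case (less n)
  show ?case
  proof (cases n)
    case 0
    then show ?thesis by (simp add: rooted_sum_empty)
  next
    case (Suc m)
    have IH: "rooted_sum w j a (a + i) = rooted_sum w j 0 i" if "i \<le> m" for i j a
      using less that Suc by simp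
    have "rooted_sum w j a (a + n) = w (Suc j) * rooted_sum w 0 0 m +
        (\<Sum>i<m. rooted_sum w 0 0 i * rooted_sum w (Suc j) 0 (m - i))" for a
      unfolding Suc rooted_sum_Suc
      by (intro arg_cong2[of _ _ _ _ "(+)"] sum.cong refl)
        (simp_all only: IH lessThan_iff less_imp_le diff_le_self order_refl)
    from this[of a] this[of 0] show ?thesis
      by simp
  qed
qed

section \<open>The functional equation of the generating function\<close>

definition nc_fps :: "(nat \<Rightarrow> 'a::comm_ring_1) \<Rightarrow> 'a fps" where
  "nc_fps w = Abs_fps (\<lambda>n. rooted_sum w 0 0 n)"

text \<open>
  The empty ground set has no root, so it is excluded here.
\<close>

definition rooted_fps :: "(nat \<Rightarrow> 'a::comm_ring_1) \<Rightarrow> nat \<Rightarrow> 'a fps" where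
  "rooted_fps w j = Abs_fps (\<lambda>n. if n = 0 then 0 else rooted_sum w j 0 n)"

lemma rooted_fps_rec:
  "rooted_fps w j = fps_X * nc_fps w * (fps_const (w (Suc j)) + rooted_fps w (Suc j))"
proof (rule fps_ext)
  fix n
  show "rooted_fps w j $ n = (fps_X * nc_fps w * (fps_const (w (Suc j)) + rooted_fps w (Suc j))) $ n"
  proof (cases n)
    case 0
    then show ?thesis by (simp add: rooted_fps_def)
  next
    case (Suc m)
    have "rooted_sum w j 0 n = w (Suc j) * rooted_sum w 0 0 m +
        (\<Sum>i<m. rooted_sum w 0 0 i * rooted_sum w (Suc j) 0 (m - i))"
      using rooted_sum_Suc[of w j 0 m] unfolding Suc rooted_sum_shift by simp
    also have "(\<Sum>i<m. rooted_sum w 0 0 i * rooted_sum w (Suc j) 0 (m - i)) =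
        (nc_fps w * rooted_fps w (Suc j)) $ m"
      unfolding fps_mult_nth nc_fps_def rooted_fps_def
      by (rule sum.mono_neutral_cong_left) auto
    finally show ?thesis
      using Suc by (simp add: rooted_fps_def nc_fps_def distrib_left mult.assoc mult.commute)
  qed
qed

lemma rooted_fps_unfold:
  "rooted_fps w 0 = (\<Sum>k<N. fps_const (w (Suc k)) * (fps_X * nc_fps w) ^ Suc k) +
    (fps_X * nc_fps w) ^ N * rooted_fps w N"
proof (induction N)
  case (Suc N)
  then show ?case
    by (subst (asm) (2) rooted_fps_rec) (simp add: algebra_simps)
qed simp

text \<open>
  After \<open>n\<close> steps the remainder in \<open>rooted_fps_unfold\<close> is divisible by \<open>X ^ (n + 1)\<close>, so it does not
  affect the coefficient of \<open>X ^ n\<close>.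
\<close>

theorem nc_fps_compose:
  "nc_fps w = 1 + (Abs_fps (\<lambda>k. if k = 0 then 0 else w k) oo (fps_X * nc_fps w))"
proof -
  let ?Y = "fps_X * nc_fps w"
  let ?W = "Abs_fps (\<lambda>k. if k = 0 then 0 else w k)"
  have "rooted_fps w 0 $ n = (?W oo ?Y) $ n" for n
  proof -
    have "(?Y ^ n * rooted_fps w n) $ n = 0"
      by (simp add: power_mult_distrib mult.assoc fps_X_power_mult_nth rooted_fps_def)
    then have "rooted_fps w 0 $ n = (\<Sum>k<n. w (Suc k) * (?Y ^ Suc k) $ n)"
      by (subst rooted_fps_unfold[of w n]) (simp add: fps_sum_nth)
    also have "\<dots> = (?W oo ?Y) $ n"
      by (simp add: fps_compose_nth atLeast0AtMost sum.atMost_shift)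
    finally show ?thesis .
  qed
  moreover have "nc_fps w = 1 + rooted_fps w 0"
    by (rule fps_ext) (simp add: nc_fps_def rooted_fps_def rooted_sum_empty)
  ultimately show ?thesis
    by (metis fps_ext)
qed

section \<open>The Catalan series\<close>

lemma catalan_fact: "catalan k = fact (2 * k) / (fact k * fact (k + 1))"
proof (cases k)
  case 0
  then show ?thesis by (simp add: catalan_def)
next
  case (Suc m)
  have "real ((2 * k) choose m) = fact (2 * k) / (fact m * fact (k + 1))"
    using Suc binomial_fact[of m "2 * k", where 'a = real] by simp
  then show ?thesis
    using Suc by (simp add: catalan_def)
qed

lemma catalan_Suc: "(real k + 2) * catalan (Suc k) = (4 * real k + 2) * catalan k"
proof -
  have "fact (2 * Suc k) = (2 * real k + 2) * (2 * real k + 1) * fact (2 * k)"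
    by (simp add: algebra_simps)
  moreover have "fact (Suc k) = (real k + 1) * fact k" "fact (Suc k + 1) = (real k + 2) * fact (k + 1)"
    by (simp_all add: algebra_simps)
  moreover have "real k + 1 \<noteq> 0" "real k + 2 \<noteq> 0"
    by linarith+
  ultimately show ?thesis
    unfolding catalan_fact
    by (simp add: divide_simps del: fact_Suc) (simp add: algebra_simps)
qed

definition catalan_fps :: "real fps" where
  "catalan_fps = Abs_fps (\<lambda>k. if k = 0 then 0 else catalan (k - 1))"

text \<open>
  By the quadratic formula the claim means that \<open>U = 1 - 2 * catalan_fps\<close> is a square root of
  \<open>1 - 4 * X\<close>. The ratio of consecutive Catalan numbers says that \<open>U\<close> solves
  \<open>(1 - 4 * X) * U' = - 2 * U\<close>, so \<open>U\<^sup>2\<close> solves \<open>(1 - 4 * X) * V' = - 4 * V\<close>. That equation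
  determines \<open>V\<close> from its constant coefficient, and the recurrence for the coefficients of \<open>V\<close>
  breaks off after the linear term.
\<close>

lemma catalan_fps_equation: "catalan_fps = fps_X + catalan_fps ^ 2"
proof -
  define U where "U = 1 - fps_const 2 * catalan_fps"
  have U_0: "U $ 0 = 1" and U_Suc: "U $ Suc n = - 2 * catalan n" for n
    by (simp_all add: U_def catalan_fps_def)
  have ode_nth: "((1 - fps_const 4 * fps_X) * fps_deriv f) $ n =
      real (n + 1) * f $ (n + 1) - 4 * real n * f $ n" for f :: "real fps" and n
    by (cases n) (simp_all add: left_diff_distrib mult.assoc)
  have ode_U: "(1 - fps_const 4 * fps_X) * fps_deriv U = - (fps_const 2 * U)"
  proof (rule fps_ext)
    fix n
    show "((1 - fps_const 4 * fps_X) * fps_deriv U) $ n = (- (fps_const 2 * U)) $ n"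
      unfolding ode_nth
    proof (cases n)
      case 0
      then show "real (n + 1) * U $ (n + 1) - 4 * real n * U $ n = (- (fps_const 2 * U)) $ n"
        by (simp add: U_0 U_Suc catalan_def)
    next
      case (Suc m)
      then show "real (n + 1) * U $ (n + 1) - 4 * real n * U $ n = (- (fps_const 2 * U)) $ n"
        using catalan_Suc[of m] by (simp add: U_Suc algebra_simps)
    qed
  qed
  have ode: "(1 - fps_const 4 * fps_X) * fps_deriv (U ^ 2) = - (fps_const 4 * U ^ 2)"
  proof -
    have "(1 - fps_const 4 * fps_X) * fps_deriv (U ^ 2) =
        2 * U * ((1 - fps_const 4 * fps_X) * fps_deriv U)"
      by (simp add: power2_eq_square algebra_simps)
    also have "\<dots> = - (2 * fps_const 2 * U ^ 2)"
      unfolding ode_U by (simp add: power2_eq_square algebra_simps)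
    also have "2 * fps_const 2 = (fps_const 4 :: real fps)"
      by (simp flip: numeral_fps_const)
    finally show ?thesis .
  qed
  have rec: "real (n + 1) * (U ^ 2) $ (n + 1) = 4 * (real n - 1) * (U ^ 2) $ n" for n
    using arg_cong[OF ode, of "\<lambda>f. f $ n"] unfolding ode_nth by (simp add: algebra_simps)
  have V_0: "(U ^ 2) $ 0 = 1"
    by (simp add: power2_eq_square U_0)
  have V_1: "(U ^ 2) $ 1 = - 4"
    using rec[of 0] V_0 by simp
  have V_ge: "(U ^ 2) $ (n + 2) = 0" for n
  proof (induction n)
    case 0
    then show ?case using rec[of 1] by (simp add: numeral_2_eq_2)
  next
    case (Suc n)
    then show ?case using rec[of "n + 2"] by simp
  qed
  have "U ^ 2 = 1 - fps_const 4 * fps_X"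
  proof (rule fps_ext)
    fix n :: nat
    consider "n = 0" | "n = 1" | m where "n = m + 2"
      using le_Suc_ex[of 2 n] by (metis One_nat_def add.commute less_2_cases not_less)
    then show "(U ^ 2) $ n = (1 - fps_const 4 * fps_X) $ n"
      by cases (simp_all only: V_0 V_1 V_ge, simp_all)
  qed
  then have "4 * catalan_fps = 4 * (fps_X + catalan_fps ^ 2)"
    unfolding U_def numeral_fps_const[symmetric] by algebra
  then show ?thesis
    by (subst (asm) mult_cancel_left) auto
qed

section \<open>Comparison with the Schroeder series\<close>

text \<open>
  The difference of the two equations factors as \<open>(D - E) * (1 - X - D - E) = 0\<close>, and the second
  factor has constant coefficient 1.
\<close>

lemma quadratic_fps_unique:
  fixes D E :: "'a::idom fps"
  assumes "D = fps_X + fps_X * D + D ^ 2" "E = fps_X + fps_X * E + E ^ 2" "D $ 0 = 0" "E $ 0 = 0"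
  shows "D = E"
proof -
  have "(D - E) * (1 - fps_X - D - E) = 0"
    using assms(1,2) by algebra
  moreover have "(1 - fps_X - D - E) $ 0 \<noteq> 0"
    using assms(3,4) by simp
  then have "1 - fps_X - D - E \<noteq> 0"
    by fastforce
  ultimately show ?thesis
    by simp
qed

theorem corollary8p4:
  fixes n :: nat
  assumes "n \<ge> 1"
  shows "schroeder n = (\<Sum>\<pi>\<in>NC (n + 1). \<Prod>S\<in>\<pi>. catalan (card S - 1))"
proof -
  define w where "w = (\<lambda>k. catalan (k - 1))"
  define D where "D = nc_fps w - 1"
  have D: "D = catalan_fps oo (fps_X * nc_fps w)"
  proof -
    have "Abs_fps (\<lambda>k. if k = 0 then 0 else w k) = catalan_fps"
      unfolding catalan_fps_def w_def ..
    then have "nc_fps w = 1 + (catalan_fps oo (fps_X * nc_fps w))"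
      using nc_fps_compose[of w] by simp
    then show ?thesis
      unfolding D_def diff_eq_eq by (rule trans[OF _ add.commute])
  qed
  have "D = (fps_X + catalan_fps ^ 2) oo (fps_X * nc_fps w)"
    using D catalan_fps_equation by simp
  also have "\<dots> = fps_X * nc_fps w + D ^ 2"
    by (simp add: D fps_compose_add_distrib fps_compose_power)
  also have "fps_X * nc_fps w = fps_X + fps_X * D"
    by (simp add: D_def algebra_simps)
  finally have "D = fps_X + fps_X * D + D ^ 2" .
  moreover have "fps_X * schroeder_fps =
      fps_X + fps_X * (fps_X * schroeder_fps) + (fps_X * schroeder_fps) ^ 2"
    using schroeder_fps_equation by algebra
  moreover have "D $ 0 = 0"
    by (simp add: D_def nc_fps_def rooted_sum_empty)
  ultimately have "D = fps_X * schroeder_fps"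
    by (rule quadratic_fps_unique) simp
  then have "schroeder n = D $ Suc n"
    by (simp add: schroeder_def)
  also have "\<dots> = rooted_sum w 0 0 (n + 1)"
    by (simp add: D_def nc_fps_def)
  \<comment> \<open>The generating function counts partitions of \<open>{0..<n + 1}\<close>, not of \<open>{1..n + 1}\<close>.\<close>
  also have "\<dots> = rooted_sum w 0 1 (1 + (n + 1))"
    by (simp only: rooted_sum_shift)
  also have "\<dots> = (\<Sum>\<pi>\<in>NC (n + 1). \<Prod>S\<in>\<pi>. w (card S))"
    by (simp add: rooted_sum_def rooted_weight_def NC_def nc_partitions_def
        atLeastLessThanSuc_atLeastAtMost)
  finally show ?thesis
    by (simp add: w_def)
qed

end
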